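(* Let $a\in G$ be an aperiodic element. Then there exists a weight $w$ on $G$ such that $T_{a,w}$ is distributionally chaotic on $L^p(G)$ for every $p\in[1,\infty)$. In particular, this operator $T_{a,w}$ is Li-Yorke chaotic on $L^p(G)$ for every $p\in[1,\infty)$.
   Context: $G$ is a second countable locally compact Hausdorff group with a right invariant Haar measure $\lambda$; $L^p(G)$ is the complex Lebesgue space with respect to $\lambda$. A weight on $G$ is a bounded continuous function $w:G\to(0,\infty)$. For $a\in G$, $(T_af)(x):=f(xa^{-1})$ and the weighted translation is $T_{a,w}f:=w\,T_af$ for $f\in L^p(G)$. An element $a\in G$ is aperiodic if the cyclic subgroup generated by $a$ is not precompact (not relatively compact) in $G$. For $A\subset\mathbb{N}=\{1,2,\dots\}$, $\overline{\mathrm{dens}}(A)=\limsup_{n\to\infty}\frac{\mathrm{card}(A\cap[1,n])}{n}$. A bounded linear operator $T$ on a Banach space $X$ is distributionally chaotic if there exist an uncountable set $\Gamma\subset X$ and $\varepsilon>0$ such that for every $\tau>0$ and every pair of distinct $x,y\in\Gamma$, $\overline{\mathrm{dens}}\{n\in\mathbb{N}:\|T^nx-T^ny\|\ge\varepsilon\}=1$ and $\overline{\mathrm{dens}}\{n\in\mathbb{N}:\|T^nx-T^ny\|<\tau\}=1$. $T$ is Li-Yorke chaotic if there is an uncountable set $\Gamma\subset X$ such that for every pair of distinct $x,y\in\Gamma$, $\liminf_{n\to\infty}\|T^nx-T^ny\|=0$ and $\limsup_{n\to\infty}\|T^nx-T^ny\|>0$. *)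

theory Defs
  imports "HOL-Analysis.Analysis"
begin

text \<open>
  Groups are written additively, since the library's class of topological groups is
  \<^class>\<open>topological_group_add\<close>. It extends \<^class>\<open>group_add\<close>, which does not assume
  commutativity: \<open>x + y\<close> stands for the product \<open>xy\<close>, and \<open>x - y = x + (- y)\<close> for \<open>x y\<^sup>-\<^sup>1\<close>,
  in this order.
\<close>

definition cyclic_subgroup :: "'a::group_add \<Rightarrow> 'a set" where
  "cyclic_subgroup a = range (\<lambda>n. ((+) a ^^ n) 0) \<union> range (\<lambda>n. - ((+) a ^^ n) 0)"

definition aperiodic :: "'a::topological_group_add \<Rightarrow> bool" where
  "aperiodic a \<longleftrightarrow> \<not> compact (closure (cyclic_subgroup a))"

definition radon_measure :: "'a::topological_space measure \<Rightarrow> bool" where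
  "radon_measure M \<longleftrightarrow>
     sets M = sets borel \<and>
     (\<forall>K. compact K \<and> K \<in> sets borel \<longrightarrow> emeasure M K < \<infinity>) \<and>
     (\<forall>E\<in>sets borel. emeasure M E = (INF U\<in>{U. open U \<and> E \<subseteq> U}. emeasure M U)) \<and>
     (\<forall>U. open U \<longrightarrow> emeasure M U = (SUP K\<in>{K. compact K \<and> K \<in> sets borel \<and> K \<subseteq> U}. emeasure M K))"

definition right_haar_measure :: "'a::topological_group_add measure \<Rightarrow> bool" where
  "right_haar_measure M \<longleftrightarrow>
     radon_measure M \<and> emeasure M UNIV \<noteq> 0 \<and>
     (\<forall>E\<in>sets borel. \<forall>g. emeasure M ((\<lambda>x. x + g) ` E) = emeasure M E)"

definition weight :: "('a::topological_space \<Rightarrow> real) \<Rightarrow> bool" where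
  "weight w \<longleftrightarrow> continuous_on UNIV w \<and> bounded (range w) \<and> (\<forall>x. 0 < w x)"

text \<open>
  The spaces \<open>L\<^sup>p\<close> vary with a term parameter \<open>p\<close>, so they cannot be types of class
  \<^class>\<open>banach\<close>; a normed space is given by its carrier and operations instead.
\<close>

record 'v normed_space =
  vectors :: "'v set"
  vadd :: "'v \<Rightarrow> 'v \<Rightarrow> 'v"
  vscale :: "complex \<Rightarrow> 'v \<Rightarrow> 'v"
  vnorm :: "'v \<Rightarrow> real"

definition vdist :: "'v normed_space \<Rightarrow> 'v \<Rightarrow> 'v \<Rightarrow> real" where
  "vdist X x y = vnorm X (vadd X x (vscale X (- 1) y))"

definition bounded_operator :: "'v normed_space \<Rightarrow> ('v \<Rightarrow> 'v) \<Rightarrow> bool" where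
  "bounded_operator X T \<longleftrightarrow>
     (\<forall>x\<in>vectors X. T x \<in> vectors X) \<and>
     (\<forall>x\<in>vectors X. \<forall>y\<in>vectors X. T (vadd X x y) = vadd X (T x) (T y)) \<and>
     (\<forall>c. \<forall>x\<in>vectors X. T (vscale X c x) = vscale X c (T x)) \<and>
     (\<exists>C. \<forall>x\<in>vectors X. vnorm X (T x) \<le> C * vnorm X x)"

text \<open>The term for \<open>n = 0\<close> is \<open>0 / 0 = 0\<close> and does not affect the upper limit.\<close>

definition upper_dens :: "nat set \<Rightarrow> ereal" where
  "upper_dens A = limsup (\<lambda>n. ereal (real (card (A \<inter> {1..n})) / real n))"

definition distributionally_chaotic :: "'v normed_space \<Rightarrow> ('v \<Rightarrow> 'v) \<Rightarrow> bool" where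
  "distributionally_chaotic X T \<longleftrightarrow>
     bounded_operator X T \<and>
     (\<exists>\<Gamma> \<epsilon>. \<Gamma> \<subseteq> vectors X \<and> uncountable \<Gamma> \<and> 0 < \<epsilon> \<and>
       (\<forall>\<tau>>0. \<forall>x\<in>\<Gamma>. \<forall>y\<in>\<Gamma>. x \<noteq> y \<longrightarrow>
          upper_dens {n. 1 \<le> n \<and> \<epsilon> \<le> vdist X ((T ^^ n) x) ((T ^^ n) y)} = 1 \<and>
          upper_dens {n. 1 \<le> n \<and> vdist X ((T ^^ n) x) ((T ^^ n) y) < \<tau>} = 1))"

definition li_yorke_chaotic :: "'v normed_space \<Rightarrow> ('v \<Rightarrow> 'v) \<Rightarrow> bool" where
  "li_yorke_chaotic X T \<longleftrightarrow>
     bounded_operator X T \<and>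
     (\<exists>\<Gamma>. \<Gamma> \<subseteq> vectors X \<and> uncountable \<Gamma> \<and>
       (\<forall>x\<in>\<Gamma>. \<forall>y\<in>\<Gamma>. x \<noteq> y \<longrightarrow>
          liminf (\<lambda>n. ereal (vdist X ((T ^^ n) x) ((T ^^ n) y))) = 0 \<and>
          limsup (\<lambda>n. ereal (vdist X ((T ^^ n) x) ((T ^^ n) y))) > 0))"

definition Lp_fun :: "'a measure \<Rightarrow> real \<Rightarrow> ('a \<Rightarrow> complex) set" where
  "Lp_fun M p = {f \<in> borel_measurable M. integrable M (\<lambda>x. norm (f x) powr p)}"

definition ae_eq :: "'a measure \<Rightarrow> real \<Rightarrow> (('a \<Rightarrow> complex) \<times> ('a \<Rightarrow> complex)) set" where
  "ae_eq M p = {(f, g). f \<in> Lp_fun M p \<and> g \<in> Lp_fun M p \<and> (AE x in M. f x = g x)}"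

definition seminorm_p :: "'a measure \<Rightarrow> real \<Rightarrow> ('a \<Rightarrow> complex) \<Rightarrow> real" where
  "seminorm_p M p f = (\<integral>x. norm (f x) powr p \<partial>M) powr (1 / p)"

text \<open>
  Vectors are almost-everywhere equality classes. All operations below are induced from
  functions to classes; each union or image over representatives collapses to a single
  class or value.
\<close>

definition Lp :: "'a measure \<Rightarrow> real \<Rightarrow> ('a \<Rightarrow> complex) set normed_space" where
  "Lp M p =
     \<lparr> vectors = Lp_fun M p // ae_eq M p,
       vadd = (\<lambda>F G. \<Union>f\<in>F. \<Union>g\<in>G. ae_eq M p `` {\<lambda>x. f x + g x}),
       vscale = (\<lambda>c F. \<Union>f\<in>F. ae_eq M p `` {\<lambda>x. c * f x}),
       vnorm = (\<lambda>F. the_elem (seminorm_p M p ` F)) \<rparr>"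

definition Lp_induced ::
  "'a measure \<Rightarrow> real \<Rightarrow> (('a \<Rightarrow> complex) \<Rightarrow> ('a \<Rightarrow> complex)) \<Rightarrow>
   ('a \<Rightarrow> complex) set \<Rightarrow> ('a \<Rightarrow> complex) set" where
  "Lp_induced M p S F = (\<Union>f\<in>F. ae_eq M p `` {S f})"

definition translation :: "'a::group_add \<Rightarrow> ('a \<Rightarrow> complex) \<Rightarrow> 'a \<Rightarrow> complex" where
  "translation a f = (\<lambda>x. f (x - a))"

definition weighted_translation ::
  "'a::group_add \<Rightarrow> ('a \<Rightarrow> real) \<Rightarrow> ('a \<Rightarrow> complex) \<Rightarrow> 'a \<Rightarrow> complex" where
  "weighted_translation a w f = (\<lambda>x. complex_of_real (w x) * translation a f x)"

end

theory Submission
  imports Defs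
begin

text \<open>
  Write \<open>na\<close> for the \<open>n\<close>-th multiple of \<open>a\<close>. If \<open>f\<close> is supported in a set \<open>E\<close>, then
  \<open>T\<^sup>n f\<close> is supported in \<open>E + na\<close>, where it is the translate of \<open>f\<close> multiplied by
  \<open>w (x + a) \<sqdot> ... \<sqdot> w (x + na)\<close>, \<open>x \<in> E\<close>. Suppose that the sets \<open>E + na\<close> are disjoint.
  Then \<open>w\<close> can be given a constant value on each of them, so that this product is
  \<open>exp (s n)\<close> for any prescribed sequence \<open>s\<close> with \<open>s 0 = 0\<close> and bounded increments, and
  right invariance of the measure gives
  \<open>\<parallel>T\<^sup>n 1\<^sub>E\<parallel> = exp (s n) \<sqdot> \<parallel>1\<^sub>E\<parallel>\<close> in every \<open>L\<^sup>p\<close>. The choice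
  \<open>s n = r sin r\<close> with \<open>r = sqrt (ln (n + 1))\<close> moves so slowly that both \<open>s n \<ge> R\<close>
  and \<open>s n \<le> - R\<close> hold on sets of upper density one, for every \<open>R\<close>
  (\<open>osc_high\<close>, \<open>osc_low\<close>). Hence the line of scalar multiples of \<open>1\<^sub>E\<close> is distributionally
  scrambled: two of its points differ by a nonzero multiple of \<open>1\<^sub>E\<close>
  (\<open>distributionally_chaotic_if_osc\<close>). The weight does not involve \<open>p\<close>. A set of upper density
  one is infinite, so Li-Yorke chaos follows.

  Such a set \<open>E\<close> exists because \<open>a\<close> is aperiodic: a compact set contains only finitely many
  of the multiples \<open>na\<close> (\<open>aperiodic_finite_visits\<close>). Otherwise the multiples would return to every
  neighbourhood of \<open>0\<close>, by compactness the returns to a compact neighbourhood would have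
  bounded gaps, and the cyclic subgroup would be precompact. Finiteness makes small translates
  disjoint and locally finite, so a sum of bump functions along the orbit gives a continuous
  logarithm of the weight (\<open>weight_along_orbit\<close>).
\<close>

section \<open>Upper density and a slow oscillation\<close>

lemma upper_dens_le_1: "upper_dens A \<le> 1"
proof -
  have "card (A \<inter> {1..n}) \<le> n" for n
    using card_mono[of "{1..n}" "A \<inter> {1..n}"] by simp
  then have "real (card (A \<inter> {1..n})) / real n \<le> 1" for n
    by (cases "n = 0") (simp_all add: divide_le_eq_1 del: One_nat_def)
  then show ?thesis
    unfolding upper_dens_def
    by (intro Limsup_bounded always_eventually allI) (simp flip: one_ereal_def)
qed

text \<open>
  An interval \<open>{m<..n} \<subseteq> A\<close> makes the proportion of \<open>A\<close> in \<open>{1..n}\<close> at least \<open>1 - m / n\<close>.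
\<close>

lemma upper_dens_eq_1:
  assumes "\<And>\<delta> N. \<delta> > 0 \<Longrightarrow> \<exists>n\<ge>N. \<exists>m. n > 0 \<and> real m \<le> \<delta> * real n \<and> {m<..n} \<subseteq> A"
  shows "upper_dens A = 1"
proof (rule antisym)
  show "upper_dens A \<le> 1" by (rule upper_dens_le_1)
next
  show "1 \<le> upper_dens A"
  proof (rule ccontr)
    assume "\<not> 1 \<le> upper_dens A"
    then have "upper_dens A < 1" by simp
    then obtain c :: real where c: "upper_dens A < ereal c" "ereal c < 1"
      by (metis ereal_dense2 one_ereal_def)
    then have "eventually (\<lambda>n. ereal (real (card (A \<inter> {1..n})) / real n) < ereal c) sequentially"
      unfolding upper_dens_def by (intro Limsup_lessD) simp
    then obtain N where N: "\<And>n. n \<ge> N \<Longrightarrow> real (card (A \<inter> {1..n})) / real n < c"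
      by (auto simp: eventually_sequentially)
    have "1 - c > 0" using c by simp
    then obtain n m where nm: "n \<ge> N" "n > 0" "real m \<le> (1 - c) * real n" "{m<..n} \<subseteq> A"
      using assms[of "1 - c" N] by blast
    have "{m<..n} \<subseteq> A \<inter> {1..n}" using nm(4) by auto
    then have "n - m \<le> card (A \<inter> {1..n})"
      using card_mono[of "A \<inter> {1..n}" "{m<..n}"] by simp
    then have "real n - real m \<le> real (card (A \<inter> {1..n}))" by linarith
    moreover have "real (card (A \<inter> {1..n})) < c * real n"
      using N[OF nm(1)] nm(2) by (simp add: divide_less_eq)
    ultimately show False using nm(3) by (simp add: algebra_simps)
  qed
qed

lemma upper_dens_mono_1:
  assumes "upper_dens A = 1" "A \<subseteq> B"
  shows "upper_dens B = 1"
proof (rule antisym)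
  show "upper_dens B \<le> 1" by (rule upper_dens_le_1)
  have "card (A \<inter> {1..n}) \<le> card (B \<inter> {1..n})" for n
    using assms(2) by (intro card_mono) auto
  then have "upper_dens A \<le> upper_dens B"
    unfolding upper_dens_def
    by (intro Limsup_mono always_eventually allI) (simp add: divide_right_mono)
  then show "1 \<le> upper_dens B" using assms(1) by simp
qed

lemma upper_dens_finite:
  assumes "finite A"
  shows "upper_dens A = 0"
proof -
  have "(\<lambda>n. real (card A) / real n) \<longlonglongrightarrow> 0" by (rule lim_const_over_n)
  moreover have "card (A \<inter> {1..n}) \<le> card A" for n using assms by (intro card_mono) auto
  ultimately have "(\<lambda>n. real (card (A \<inter> {1..n})) / real n) \<longlonglongrightarrow> 0"
    by (rule_tac tendsto_sandwich[of "\<lambda>_. 0"]) (auto intro!: always_eventually divide_right_mono)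
  then have "(\<lambda>n. ereal (real (card (A \<inter> {1..n})) / real n)) \<longlonglongrightarrow> ereal 0" by simp
  then show ?thesis unfolding upper_dens_def
    by (metis lim_imp_Limsup sequentially_bot zero_ereal_def)
qed

lemma infinite_if_upper_dens_1: "upper_dens A = 1 \<Longrightarrow> infinite A"
  using upper_dens_finite by force

text \<open>
  The logarithm of the norm growth along the orbit. In the variable \<open>r = sqrt (ln (n + 1))\<close> it is
  \<open>r sin r\<close>; an interval of \<open>r\<close> of fixed length, far out, covers an interval of \<open>n\<close> whose endpoints have an
  arbitrarily large ratio.
\<close>

definition osc :: "nat \<Rightarrow> real" where
  "osc n = sqrt (ln (real n + 1)) * sin (sqrt (ln (real n + 1)))"

lemma osc_0 [simp]: "osc 0 = 0"
  by (simp add: osc_def)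

lemma abs_sin_diff_le: "\<bar>sin x - sin y\<bar> \<le> \<bar>x - y\<bar>" for x y :: real
proof -
  have "\<bar>sin x - sin y\<bar> = 2 * \<bar>sin ((x - y) / 2)\<bar> * \<bar>cos ((x + y) / 2)\<bar>"
    by (simp add: sin_diff_sin abs_mult)
  also have "\<dots> \<le> 2 * \<bar>(x - y) / 2\<bar> * 1"
    using abs_sin_x_le_abs_x[of "(x - y) / 2"] abs_cos_le_one[of "(x + y) / 2"]
    by (intro mult_mono) auto
  finally show ?thesis by simp
qed

text \<open>
  With \<open>r\<close> and \<open>r'\<close> at two consecutive indices, the increment is at most
  \<open>(r' - r) + r (r' - r)\<close>, and both terms are controlled by
  \<open>(r' - r) (r' + r) = r'\<^sup>2 - r\<^sup>2 \<le> 1\<close>.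
\<close>

lemma osc_step: "\<bar>osc (Suc n) - osc n\<bar> \<le> 2"
proof -
  define r where "r n = sqrt (ln (real n + 1))" for n
  have r0: "r n \<ge> 0" for n by (simp add: r_def)
  have mono: "r n \<le> r (Suc n)" by (simp add: r_def)
  have "ln (real n + 2) - ln (real n + 1) \<le> 1"
  proof -
    have "ln (real n + 2) - ln (real n + 1) = ln ((real n + 2) / (real n + 1))"
      by (simp add: ln_div)
    also have "\<dots> \<le> (real n + 2) / (real n + 1) - 1"
      by (intro ln_le_minus_one) auto
    also have "\<dots> \<le> 1" by (simp add: field_simps)
    finally show ?thesis .
  qed
  then have sq: "(r (Suc n))\<^sup>2 - (r n)\<^sup>2 \<le> 1" by (simp add: r_def algebra_simps)
  have "(r (Suc n) - r n) * (r (Suc n) - r n) \<le> (r (Suc n) - r n) * (r (Suc n) + r n)"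
    using mono r0[of n] by (intro mult_left_mono) auto
  also have "\<dots> = (r (Suc n))\<^sup>2 - (r n)\<^sup>2" by (simp add: power2_eq_square algebra_simps)
  finally have "(r (Suc n) - r n)\<^sup>2 \<le> 1\<^sup>2" using sq by (simp add: power2_eq_square)
  then have d1: "r (Suc n) - r n \<le> 1" by (rule power2_le_imp_le) simp
  have d2: "r n * (r (Suc n) - r n) \<le> 1"
  proof -
    have "r n * (r (Suc n) - r n) \<le> (r (Suc n) + r n) * (r (Suc n) - r n)"
      using mono r0 by (intro mult_right_mono) auto
    then show ?thesis using sq by (simp add: power2_eq_square algebra_simps)
  qed
  have "osc (Suc n) - osc n = (r (Suc n) - r n) * sin (r (Suc n)) + r n * (sin (r (Suc n)) - sin (r n))"
    by (simp add: osc_def r_def algebra_simps)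
  also have "\<bar>\<dots>\<bar> \<le> (r (Suc n) - r n) * 1 + r n * (r (Suc n) - r n)"
    using mono r0[of n] abs_sin_diff_le[of "r (Suc n)" "r n"]
    by (intro order.trans[OF abs_triangle_ineq] add_mono) (auto simp: abs_mult intro!: mult_left_mono mult_left_le)
  finally show ?thesis using d1 d2 by simp
qed

lemma sin_ge_half:
  fixes t :: real
  assumes "1 \<le> t" "t \<le> 2"
  shows "sin t \<ge> 1 / 2"
proof -
  have ge: "1 / 2 \<le> sin x" if "1 \<le> x" "x \<le> pi / 2" for x :: real
    using sin_mono_le_eq[of "pi / 6" x] that pi_less_4 pi_gt3 by (simp add: sin_30)
  show ?thesis
  proof (cases "t \<le> pi / 2")
    case False
    then show ?thesis using ge[of "pi - t"] assms pi_gt3 by simp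
  qed (use ge assms in auto)
qed

text \<open>
  On \<open>r \<in> [q k + 1, q k + 2]\<close> the factor \<open>\<sigma> sin r\<close> is at least \<open>1/2\<close>, so \<open>\<sigma> r sin r\<close> is large.
  In terms of \<open>n\<close> this is the interval from about \<open>exp ((q k + 1)\<^sup>2)\<close> to about \<open>exp ((q k + 2)\<^sup>2)\<close>,
  and the ratio of the endpoints tends to infinity. The sign \<open>\<sigma>\<close> covers crests and troughs
  together.
\<close>

lemma osc_upper_dens:
  assumes q: "filterlim q at_top sequentially"
    and sgn: "\<And>k t. \<sigma> * sin (q k + t) = sin t"
  shows "upper_dens {n. 1 \<le> n \<and> R \<le> \<sigma> * osc n} = 1"
proof (rule upper_dens_eq_1)
  fix \<delta> :: real and N assume "\<delta> > 0"
  \<comment> \<open>The three terms make \<open>n\<close> exceed \<open>N\<close>, the ratio \<open>m / n\<close> small, and \<open>r / 2\<close> exceed \<open>R\<close>.\<close>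
  define M where "M = max (real N) (2 / \<delta>) + \<bar>2 * R\<bar> + 1"
  obtain k where k: "q k \<ge> M"
    using q by (metis eventually_sequentially filterlim_at_top order_refl)
  define n m where "n = nat \<lfloor>exp ((q k + 2)\<^sup>2)\<rfloor> - 1" and "m = nat \<lfloor>exp ((q k + 1)\<^sup>2)\<rfloor>"
  have M: "q k \<ge> real N" "q k \<ge> 2 / \<delta>" "q k \<ge> 2 * R" "q k \<ge> 1" "M \<ge> 1"
    using k by (auto simp: M_def)
  have "1 + (q k + 2)\<^sup>2 \<le> exp ((q k + 2)\<^sup>2)" by (rule exp_ge_add_one_self)
  moreover have "(q k + 2)\<^sup>2 \<ge> q k + 2" using M by (simp add: power2_eq_square)
  ultimately have big: "q k + 3 \<le> exp ((q k + 2)\<^sup>2)" by linarith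
  have n: "real n + 1 \<le> exp ((q k + 2)\<^sup>2)" "exp ((q k + 2)\<^sup>2) \<le> real n + 2"
    using big M unfolding n_def by linarith+
  have m: "real m \<le> exp ((q k + 1)\<^sup>2)" "exp ((q k + 1)\<^sup>2) \<le> real m + 1"
    using floor_correct[of "exp ((q k + 1)\<^sup>2)"] by (simp_all add: m_def)
  have nq: "real n \<ge> q k" using big n by linarith
  have "\<delta> * q k \<ge> 2" using M(2) \<open>\<delta> > 0\<close> by (simp add: field_simps)
  have "exp ((q k + 1)\<^sup>2) * (2 * q k) \<le> exp ((q k + 1)\<^sup>2) * exp (2 * q k + 3)"
    using exp_ge_add_one_self[of "2 * q k + 3"] M by (intro mult_left_mono) auto
  also have "\<dots> = exp ((q k + 2)\<^sup>2)"
    by (simp add: power2_eq_square algebra_simps flip: exp_add)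
  also have "\<dots> \<le> 2 * real n" using n nq big M by linarith
  finally have "real m * q k \<le> real n" 
    using mult_right_mono[OF m(1), of "q k"] M by linarith
  then have "real m * q k * \<delta> \<le> \<delta> * real n" using \<open>\<delta> > 0\<close> by (simp add: mult.commute)
  moreover have "real m * 1 \<le> real m * (\<delta> * q k)"
    using \<open>\<delta> * q k \<ge> 2\<close> by (intro mult_left_mono) auto
  ultimately have "real m \<le> \<delta> * real n" by (simp add: algebra_simps)
  moreover have "n \<ge> N" "n > 0" using nq M by auto
  moreover have "{m<..n} \<subseteq> {n. 1 \<le> n \<and> R \<le> \<sigma> * osc n}"
  proof
    fix i assume i: "i \<in> {m<..n}"
    define r where "r = sqrt (ln (real i + 1))"
    have "exp ((q k + 1)\<^sup>2) \<le> real i + 1" "real i + 1 \<le> exp ((q k + 2)\<^sup>2)"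
      using i m n by auto
    then have "(q k + 1)\<^sup>2 \<le> ln (real i + 1)" "ln (real i + 1) \<le> ln (exp ((q k + 2)\<^sup>2))"
      by (simp add: ln_ge_iff, intro ln_mono) auto
    then have r: "q k + 1 \<le> r" "r \<le> q k + 2"
      unfolding r_def using M by (auto intro: real_le_rsqrt real_le_lsqrt)
    have "\<sigma> * osc i = r * sin (r - q k)"
      using sgn[of k "r - q k"] by (simp add: osc_def r_def)
    moreover have "r * sin (r - q k) \<ge> r * (1 / 2)"
      using r M by (intro mult_left_mono sin_ge_half) auto
    ultimately have "R \<le> \<sigma> * osc i" using r M by linarith
    then show "i \<in> {n. 1 \<le> n \<and> R \<le> \<sigma> * osc n}" using i by auto
  qed
  ultimately show "\<exists>n\<ge>N. \<exists>m. n > 0 \<and> real m \<le> \<delta> * real n \<and> {m<..n} \<subseteq> {n. 1 \<le> n \<and> R \<le> \<sigma> * osc n}"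
    by blast
qed

lemma sin_add_periodic_nat: "sin (t + real k * (2 * pi)) = sin t"
proof (induction k)
  case (Suc k)
  have "t + real (Suc k) * (2 * pi) = (t + real k * (2 * pi)) + 2 * pi"
    by (simp add: algebra_simps)
  then show ?case using Suc by (simp only: sin_periodic)
qed simp

lemma osc_high: "upper_dens {n. 1 \<le> n \<and> R \<le> osc n} = 1"
proof -
  have "filterlim (\<lambda>k. real k * (2 * pi)) at_top sequentially"
    by (intro filterlim_at_top_mult_tendsto_pos[OF tendsto_const _ filterlim_real_sequentially]) auto
  moreover have "1 * sin (real k * (2 * pi) + t) = sin t" for k t
    using sin_add_periodic_nat[of t k] by (simp add: add.commute)
  ultimately show ?thesis using osc_upper_dens[of "\<lambda>k. real k * (2 * pi)" 1] by simp
qed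

lemma osc_low: "upper_dens {n. 1 \<le> n \<and> osc n \<le> R} = 1"
proof -
  have "filterlim (\<lambda>k. real k * (2 * pi)) at_top sequentially"
    by (intro filterlim_at_top_mult_tendsto_pos[OF tendsto_const _ filterlim_real_sequentially]) auto
  then have "filterlim (\<lambda>k. pi + real k * (2 * pi)) at_top sequentially"
    by (intro filterlim_tendsto_add_at_top[OF tendsto_const])
  moreover have "- 1 * sin ((pi + real k * (2 * pi)) + t) = sin t" for k t
    using sin_add_periodic_nat[of "t + pi" k] by (simp add: algebra_simps)
  ultimately have "upper_dens {n. 1 \<le> n \<and> - R \<le> - 1 * osc n} = 1"
    by (rule osc_upper_dens)
  then show ?thesis by simp
qed

section \<open>Multiples of an aperiodic element\<close>

definition multiple :: "'a::group_add \<Rightarrow> nat \<Rightarrow> 'a" where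
  "multiple a n = ((+) a ^^ n) 0"

lemma multiple_0 [simp]: "multiple a 0 = 0"
  by (simp add: multiple_def)

lemma multiple_Suc [simp]: "multiple a (Suc n) = a + multiple a n"
  by (simp add: multiple_def)

lemma multiple_add: "multiple a (m + n) = multiple a m + multiple a n"
  by (induction m) (simp_all add: add.assoc)

lemma multiple_Suc_right: "multiple a (Suc n) = multiple a n + a"
  using multiple_add[of a n 1] by simp

lemma multiple_diff:
  assumes "n \<le> m"
  shows "multiple a (m - n) = multiple a m - multiple a n"
  using multiple_add[of a "m - n" n] assms by (simp add: algebra_simps)

lemma multiple_diff_left:
  assumes "n \<le> m"
  shows "multiple a (m - n) = - multiple a n + multiple a m"
  using multiple_add[of a n "m - n"] assms by (simp add: add.assoc[symmetric])

lemma cyclic_subgroup_multiples: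
  "cyclic_subgroup a = range (multiple a) \<union> range (\<lambda>n. - multiple a n)"
  by (simp add: cyclic_subgroup_def multiple_def[abs_def])

lemma open_add_preimage:
  fixes x y :: "'a::topological_group_add"
  assumes "open W" "x + y \<in> W"
  obtains A B where "open A" "open B" "x \<in> A" "y \<in> B" "\<And>u v. u \<in> A \<Longrightarrow> v \<in> B \<Longrightarrow> u + v \<in> W"
proof -
  have "continuous_on UNIV (\<lambda>p::'a \<times> 'a. fst p + snd p)"
    by (intro continuous_intros)
  then have "open ((\<lambda>p::'a \<times> 'a. fst p + snd p) -` W)"
    using assms(1) by (intro open_vimage) auto
  moreover have "(x, y) \<in> (\<lambda>p. fst p + snd p) -` W" using assms by simp
  ultimately obtain A B where "open A" "open B" "(x, y) \<in> A \<times> B"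
    "A \<times> B \<subseteq> (\<lambda>p. fst p + snd p) -` W"
    by (rule open_prod_elim)
  then show ?thesis by (intro that[of A B]) auto
qed

text \<open>
  Continuity of \<open>(u, v) \<mapsto> - u + v\<close> on the diagonal, where this map vanishes.
\<close>

lemma open_diff_left_preimage:
  fixes W :: "'a::topological_group_add set"
  assumes "open W" "0 \<in> W"
  obtains P where "open P" "x \<in> P" "\<And>u v. u \<in> P \<Longrightarrow> v \<in> P \<Longrightarrow> - u + v \<in> W"
proof -
  have "- x + x \<in> W" using assms by simp
  then obtain A B where AB: "open A" "open B" "- x \<in> A" "x \<in> B"
    "\<And>u v. u \<in> A \<Longrightarrow> v \<in> B \<Longrightarrow> u + v \<in> W"
    using assms(1) open_add_preimage by metis
  have "continuous_on UNIV (\<lambda>u::'a. - u)" by (intro continuous_intros)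
  then have "open (uminus -` A)" using AB by (intro open_vimage) auto
  then show ?thesis using AB by (intro that[of "uminus -` A \<inter> B"]) auto
qed

text \<open>
  The visits to \<open>C\<close> have a convergent subsequence, and differences of two late terms of it are
  multiples of \<open>a\<close> close to \<open>0\<close>; fixing one term and moving the other makes the index large.
\<close>

lemma recurrent_multiples:
  fixes a :: "'a::{topological_group_add, second_countable_topology, t2_space}"
  assumes C: "compact C" and inf: "infinite {n. multiple a n \<in> C}"
    and U: "open U" "0 \<in> U"
  shows "\<exists>n\<ge>N. multiple a n \<in> U"
proof -
  define r where "r = enumerate {n. multiple a n \<in> C}"
  have r: "strict_mono r" "\<And>k. multiple a (r k) \<in> C"
    using strict_mono_enumerate[OF inf] enumerate_in_set[OF inf] by (auto simp: r_def)
  have "seq_compact C" using C by (simp add: seq_compact_eq_compact)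
  then obtain l q where q: "strict_mono q" "(\<lambda>k. multiple a (r (q k))) \<longlonglongrightarrow> l"
    using r(2) by (metis (no_types, lifting) seq_compact_def o_def ext)
  obtain P where P: "open P" "l \<in> P" "\<And>u v. u \<in> P \<Longrightarrow> v \<in> P \<Longrightarrow> - u + v \<in> U"
    using open_diff_left_preimage[OF U] by metis
  from q(2) P have "eventually (\<lambda>k. multiple a (r (q k)) \<in> P) sequentially"
    by (simp add: topological_tendstoD)
  then obtain k0 where k0: "\<And>k. k \<ge> k0 \<Longrightarrow> multiple a (r (q k)) \<in> P"
    by (auto simp: eventually_sequentially)
  define k1 where "k1 = k0 + N + r (q k0)"
  have rq: "strict_mono (\<lambda>k. r (q k))" using r q by (auto simp: strict_mono_def)
  have "k1 \<le> r (q k1)" using strict_mono_imp_increasing[OF rq] by simp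
  then have "N \<le> r (q k1) - r (q k0)" "r (q k0) \<le> r (q k1)" by (auto simp: k1_def)
  moreover from this have "multiple a (r (q k1) - r (q k0)) \<in> U"
    using P(3)[OF k0[of k0] k0[of k1]] by (simp add: multiple_diff_left k1_def)
  ultimately show ?thesis by blast
qed

lemma compact_neighbourhood:
  assumes "locally_compact_space (euclidean :: 'a::topological_space topology)"
  obtains U K where "open U" "compact K" "x \<in> U" "U \<subseteq> (K :: 'a set)"
  using assms unfolding locally_compact_space_def by (metis UNIV_I open_openin compactin_euclidean_iff topspace_euclidean)

text \<open>
  The argument behind the dichotomy for monothetic groups. By recurrence, every point of the
  closure \<open>H\<close> of the cyclic subgroup is carried into a given neighbourhood \<open>V\<close> of \<open>0\<close> by some
  positive multiple of \<open>a\<close>. For compact \<open>V\<close> the number of steps is bounded on \<open>V \<inter> H\<close> by some \<open>N\<close>,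
  so each positive multiple of \<open>a\<close> comes at most \<open>N\<close> steps after one that lies in \<open>V\<close>.
\<close>

lemma compact_closure_cyclic_subgroup:
  fixes a :: "'a::{topological_group_add, second_countable_topology, t2_space}"
  assumes lc: "locally_compact_space (euclidean :: 'a topology)"
    and C: "compact C" and inf: "infinite {n. multiple a n \<in> C}"
  shows "compact (closure (cyclic_subgroup a))"
proof -
  let ?H = "closure (cyclic_subgroup a)"
  obtain V0 V where V: "open V0" "compact V" "(0::'a) \<in> V0" "V0 \<subseteq> V"
    using compact_neighbourhood[OF lc] by blast
  have in_H: "multiple a n \<in> ?H" for n
    using closure_subset by (fastforce simp: cyclic_subgroup_multiples)
  have return: "\<exists>m\<ge>1. h + multiple a m \<in> V0" if "h \<in> ?H" for h
  proof -
    obtain A B where AB: "open A" "open B" "(0::'a) \<in> A" "0 \<in> B"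
      "\<And>u v. u \<in> A \<Longrightarrow> v \<in> B \<Longrightarrow> u + v \<in> V0"
      using open_add_preimage[of V0 0 0] V by auto
    have "continuous_on UNIV (\<lambda>g. h - g)" by (intro continuous_intros)
    then have "open ((\<lambda>g. h - g) -` A)" using AB by (intro open_vimage) auto
    moreover have "h \<in> (\<lambda>g. h - g) -` A" using AB by simp
    ultimately have "(\<lambda>g. h - g) -` A \<inter> cyclic_subgroup a \<noteq> {}"
      using that by (metis IntI empty_iff open_Int_closure_eq_empty)
    then obtain g where g: "g \<in> cyclic_subgroup a" "h - g \<in> A" by blast
    then consider k where "g = multiple a k" | k where "g = - multiple a k"
      by (auto simp: cyclic_subgroup_multiples)
    then have "\<exists>m\<ge>1. \<exists>n. multiple a m = - g + multiple a n \<and> multiple a n \<in> B"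
    proof cases
      case 1
      obtain n where n: "n \<ge> k + 1" "multiple a n \<in> B"
        using recurrent_multiples[OF C inf AB(2,4)] by blast
      then show ?thesis using multiple_diff_left[of k n a] 1
        by (intro exI[of _ "n - k"] conjI exI[of _ n]) auto
    next
      case 2
      obtain n where n: "n \<ge> 1" "multiple a n \<in> B"
        using recurrent_multiples[OF C inf AB(2,4)] by blast
      then show ?thesis using multiple_add[of a k n] 2
        by (intro exI[of _ "k + n"] conjI exI[of _ n]) auto
    qed
    then obtain m n where m: "m \<ge> 1" "multiple a m = - g + multiple a n" "multiple a n \<in> B"
      by blast
    then have "h + multiple a m = (h - g) + multiple a n"
      by (simp add: diff_conv_add_uminus add.assoc del: add_uminus_conv_diff)
    then show ?thesis using AB(5)[OF g(2) m(3)] m(1) by auto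
  qed
  have "compact (V \<inter> ?H)" using V by (intro compact_Int_closed) auto
  moreover have "V \<inter> ?H \<subseteq> (\<Union>m\<in>{1..}. (\<lambda>h. h + multiple a m) -` V0)"
    using return by fastforce
  moreover have "open ((\<lambda>h. h + multiple a m) -` V0)" for m
    using V(1) by (intro open_vimage continuous_intros) auto
  ultimately obtain D where D: "D \<subseteq> {1..}" "finite D"
      "V \<inter> ?H \<subseteq> (\<Union>m\<in>D. (\<lambda>h. h + multiple a m) -` V0)"
    using compactE_image[of "V \<inter> ?H" "{1..}" "\<lambda>m. (\<lambda>h. h + multiple a m) -` V0"] by metis
  obtain N where N: "\<And>m. m \<in> D \<Longrightarrow> m \<le> N"
    using D(2) finite_nat_set_iff_bounded_le by auto
  have gap: "\<exists>m. 1 \<le> m \<and> m \<le> N \<and> h + multiple a m \<in> V" if h: "h \<in> V" "h \<in> ?H" for h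
  proof -
    obtain m where m: "m \<in> D" "h + multiple a m \<in> V0" using subsetD[OF D(3), of h] h by auto
    then show ?thesis using D(1) N V(4) by (intro exI[of _ m]) auto
  qed
  \<comment> \<open>Walk from one visit to the next; at the time \<open>k\<close> the last visit is at most \<open>N\<close> steps old.\<close>
  have visit: "\<exists>i\<le>k. k - i \<le> N \<and> multiple a i \<in> V" for k
  proof (induction k)
    case 0
    then show ?case using V by auto
  next
    case (Suc k)
    then obtain i where i: "i \<le> k" "k - i \<le> N" "multiple a i \<in> V" by blast
    show ?case
    proof (cases "Suc k - i \<le> N")
      case True
      then show ?thesis using i by (intro exI[of _ i]) auto
    next
      case False
      obtain m where "1 \<le> m" "m \<le> N" "multiple a i + multiple a m \<in> V"
        using gap[OF i(3) in_H] by blast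
      then show ?thesis using i False
        by (intro exI[of _ "i + m"]) (auto simp: multiple_add)
    qed
  qed
  define E where "E = (\<Union>j\<le>N. (\<lambda>v. v + multiple a j) ` V)"
  have E: "compact E" unfolding E_def
    using V by (intro compact_UN compact_continuous_image continuous_intros) auto
  have orbit: "multiple a k \<in> E" for k
  proof -
    obtain i where i: "i \<le> k" "k - i \<le> N" "multiple a i \<in> V" using visit by blast
    then have "multiple a k = multiple a i + multiple a (k - i)"
      by (simp add: multiple_add[symmetric])
    then show ?thesis using i by (auto simp: E_def)
  qed
  have "compact (E \<union> uminus ` E)"
    using E by (intro compact_Un compact_continuous_image continuous_intros) auto
  moreover have "cyclic_subgroup a \<subseteq> E \<union> uminus ` E"
    using orbit by (auto simp: cyclic_subgroup_multiples)
  ultimately show ?thesis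
    by (metis closure_minimal closed_closure compact_imp_closed closed_Int_compact inf.absorb1)
qed

lemma aperiodic_finite_visits:
  fixes a :: "'a::{topological_group_add, second_countable_topology, t2_space}"
  assumes "locally_compact_space (euclidean :: 'a topology)" "aperiodic a" "compact C"
  shows "finite {n. multiple a n \<in> C}"
  using compact_closure_cyclic_subgroup assms unfolding aperiodic_def by blast

text \<open>
  If \<open>na = 0\<close>, then the compact set \<open>{0}\<close> is visited at all multiples of \<open>n\<close>.
\<close>

lemma aperiodic_multiple_nonzero:
  fixes a :: "'a::{topological_group_add, second_countable_topology, t2_space}"
  assumes "locally_compact_space (euclidean :: 'a topology)" "aperiodic a" "n > 0"
  shows "multiple a n \<noteq> 0"
proof
  assume "multiple a n = 0"
  then have "multiple a (n * k) = 0" for k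
    by (induction k) (auto simp: multiple_add)
  then have "range (\<lambda>k. n * k) \<subseteq> {m. multiple a m \<in> {0}}" by auto
  moreover have "infinite (range (\<lambda>k. n * k))"
    using \<open>n > 0\<close> by (intro range_inj_infinite) (auto intro: injI)
  ultimately show False
    using aperiodic_finite_visits[OF assms(1,2), of "{0}"] finite_subset by auto
qed

section \<open>A weight with prescribed values along an orbit\<close>

text \<open>
  Locally compact Hausdorff spaces are completely regular. Truncating a separating function
  makes it constant on a whole neighbourhood \<open>E\<close> of \<open>x\<close>, so that a weight built from it is
  constant on translates of \<open>E\<close>.
\<close>

lemma bump_function:
  fixes P :: "'a::t2_space set"
  assumes lc: "locally_compact_space (euclidean :: 'a topology)" and P: "open P" "x \<in> P"
  obtains f :: "'a \<Rightarrow> real" and E where "continuous_on UNIV f" "open E" "x \<in> E" "E \<subseteq> P"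
    "\<And>y. y \<in> E \<Longrightarrow> f y = 1" "\<And>y. f y \<noteq> 0 \<Longrightarrow> y \<in> P" "\<And>y. 0 \<le> f y" "\<And>y. f y \<le> 1"
proof -
  have "Hausdorff_space (euclidean :: 'a topology)"
    unfolding Hausdorff_space_def disjnt_def using hausdorff
    by (metis open_openin)
  then have "completely_regular_space (euclidean :: 'a topology)"
    using lc locally_compact_Hausdorff_imp_regular_space
      locally_compact_regular_imp_completely_regular_space by blast
  then obtain g :: "'a \<Rightarrow> real" where g: "continuous_on UNIV g" "g x = 0" "g ` (- P) \<subseteq> {1}"
    using P unfolding completely_regular_space_alt'
    by (force simp: Compl_eq_Diff_UNIV)
  \<comment> \<open>Equal to \<open>1\<close> where \<open>g \<le> 1/3\<close> and to \<open>0\<close> where \<open>g \<ge> 2/3\<close>.\<close>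
  define f where "f y = max 0 (min 1 (2 - 3 * g y))" for y
  show thesis
  proof (rule that[of f "g -` {..<1/3}"])
    show "continuous_on UNIV f" unfolding f_def using g by (intro continuous_intros)
    show "open (g -` {..<1/3})" using g by (intro open_vimage) auto
    show "g -` {..<1/3} \<subseteq> P" using g by force
    show "\<And>y. f y \<noteq> 0 \<Longrightarrow> y \<in> P" using g by (force simp: f_def)
  qed (auto simp: f_def g)
qed

text \<open>
  If \<open>P + ma\<close> and \<open>P + na\<close> meet, then \<open>(m - n)a\<close> lies in \<open>- P + P\<close>. It therefore suffices that
  \<open>- P + P\<close> stays in a relatively compact neighbourhood of \<open>0\<close> from which the finitely many multiples
  \<open>na\<close>, \<open>n > 0\<close>, in it have been removed.
\<close>

lemma disjoint_neighbourhood: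
  fixes a :: "'a::{topological_group_add, second_countable_topology, t2_space}"
  assumes lc: "locally_compact_space (euclidean :: 'a topology)" and a: "aperiodic a"
  obtains P K where "open P" "0 \<in> P" "P \<subseteq> K" "compact K"
    "\<And>x m n. x - multiple a m \<in> P \<Longrightarrow> x - multiple a n \<in> P \<Longrightarrow> m = n"
proof -
  obtain V K where V: "open V" "compact K" "(0::'a) \<in> V" "V \<subseteq> K"
    using compact_neighbourhood[OF lc] by blast
  define F where "F = multiple a ` {n. n > 0 \<and> multiple a n \<in> K}"
  have "finite F" unfolding F_def using aperiodic_finite_visits[OF lc a V(2)]
    by (intro finite_imageI) (auto elim: rev_finite_subset)
  then have "open (V - F)" using V by (simp add: finite_imp_closed open_Diff)
  moreover have "0 \<in> V - F"
    using V aperiodic_multiple_nonzero[OF lc a] by (force simp: F_def)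
  ultimately obtain P where P: "open P" "0 \<in> P" "\<And>u v. u \<in> P \<Longrightarrow> v \<in> P \<Longrightarrow> - u + v \<in> V - F"
    using open_diff_left_preimage by metis
  have avoid: "multiple a n \<notin> V - F" if "n > 0" for n
    using that V by (auto simp: F_def)
  have disj: "\<not> n < m" if x: "x - multiple a m \<in> P" "x - multiple a n \<in> P" for x m n
  proof
    assume "n < m"
    have "- (x - multiple a m) + (x - multiple a n) = multiple a m - multiple a n"
      by (simp add: diff_conv_add_uminus add.assoc minus_add del: add_uminus_conv_diff)
    then have "multiple a (m - n) \<in> V - F"
      using P(3)[OF x] multiple_diff[of n m a] \<open>n < m\<close> by simp
    then show False using avoid[of "m - n"] \<open>n < m\<close> by simp
  qed
  show thesis
  proof (rule that[of P K])
    show "P \<subseteq> K" using P(3)[OF P(2)] V by auto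
    show "m = n" if "x - multiple a m \<in> P" "x - multiple a n \<in> P" for x m n
      using disj that by (meson linorder_neqE_nat)
  qed (use P V in auto)
qed

text \<open>
  If \<open>y\<close> is in \<open>K + na\<close> and in a compact neighbourhood \<open>C\<close> of \<open>x\<close>, then \<open>na\<close> is in the compact set
  \<open>- K + C\<close>.
\<close>

lemma locally_finite_translates:
  fixes a :: "'a::{topological_group_add, second_countable_topology, t2_space}"
  assumes lc: "locally_compact_space (euclidean :: 'a topology)" and a: "aperiodic a"
    and K: "compact K"
  obtains U where "open U" "x \<in> U" "finite {n. \<exists>y\<in>U. y - multiple a n \<in> K}"
proof -
  obtain U C where U: "open U" "compact C" "x \<in> U" "U \<subseteq> C"
    using compact_neighbourhood[OF lc] by blast
  define D where "D = (\<lambda>(q, y). - q + y) ` (K \<times> C)"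
  have "compact D" unfolding D_def split_def
    using K U by (intro compact_continuous_image compact_Times continuous_intros) auto
  have "multiple a n \<in> D" if "y \<in> U" "y - multiple a n \<in> K" for y n
  proof -
    have "multiple a n = - (y - multiple a n) + y"
      by (simp add: diff_conv_add_uminus add.assoc minus_add del: add_uminus_conv_diff)
    then show ?thesis using that U by (force simp: D_def)
  qed
  then have "{n. \<exists>y\<in>U. y - multiple a n \<in> K} \<subseteq> {n. multiple a n \<in> D}" by auto
  then show thesis using that[OF U(1,3)] aperiodic_finite_visits[OF lc a \<open>compact D\<close>]
    by (meson finite_subset)
qed

text \<open>
  The logarithm of the weight is \<open>b n\<close> times a translated bump function on \<open>P + na\<close>. It is bounded
  because these sets are disjoint, and continuous because they are locally finite.
\<close>

lemma weight_along_orbit: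
  fixes a :: "'a::{topological_group_add, second_countable_topology, t2_space}"
  assumes lc: "locally_compact_space (euclidean :: 'a topology)" and a: "aperiodic a"
    and b: "\<And>n. \<bar>b n\<bar> \<le> B"
  obtains w E K where "weight w" "open E" "0 \<in> E" "E \<subseteq> K" "compact K"
    "\<And>x n. x \<in> E \<Longrightarrow> w (x + multiple a n) = exp (b n)"
proof -
  obtain P K where P: "open P" "0 \<in> P" "P \<subseteq> K" "compact K"
    "\<And>x m n. x - multiple a m \<in> P \<Longrightarrow> x - multiple a n \<in> P \<Longrightarrow> m = n"
    using disjoint_neighbourhood[OF lc a] by blast
  obtain f :: "'a \<Rightarrow> real" and E where f: "continuous_on UNIV f" and E: "open E" "0 \<in> E" "E \<subseteq> P"
    and f1: "\<And>y. y \<in> E \<Longrightarrow> f y = 1" and f0: "\<And>y. f y \<noteq> 0 \<Longrightarrow> y \<in> P"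
    and fb: "\<And>y. 0 \<le> f y" "\<And>y. f y \<le> 1"
    using bump_function[OF lc P(1,2)] by metis
  define I where "I x = {n. x - multiple a n \<in> P}" for x
  define u where "u x = (\<Sum>n\<in>I x. b n * f (x - multiple a n))" for x
  have I: "I x = {} \<or> (\<exists>n. I x = {n})" for x
    using P(5) unfolding I_def by blast
  have "B \<ge> 0" using b[of 0] by linarith
  have u_bound: "\<bar>u x\<bar> \<le> B" for x
  proof -
    have "\<bar>b n * f y\<bar> \<le> B * 1" for n y
      unfolding abs_mult using b fb \<open>B \<ge> 0\<close> by (intro mult_mono) auto
    then show ?thesis using I[of x] \<open>B \<ge> 0\<close> by (auto simp: u_def)
  qed
  have "isCont u x" for x
  proof -
    obtain U where U: "open U" "x \<in> U" "finite {n. \<exists>y\<in>U. y - multiple a n \<in> K}" (is "finite ?F")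
      using locally_finite_translates[OF lc a P(4)] by blast
    have "u y = (\<Sum>n\<in>?F. b n * f (y - multiple a n))" if "y \<in> U" for y
      unfolding u_def
    proof (rule sum.mono_neutral_left)
      show "I y \<subseteq> ?F" using that P(3) by (auto simp: I_def)
    qed (use U f0 I_def in auto)
    then have "eventually (\<lambda>y. u y = (\<Sum>n\<in>?F. b n * f (y - multiple a n))) (nhds x)"
      using U by (auto simp: eventually_nhds)
    moreover have "continuous_on UNIV (\<lambda>y. \<Sum>n\<in>?F. b n * f (y - multiple a n))"
      by (intro continuous_intros continuous_on_compose2[OF f]) auto
    then have "isCont (\<lambda>y. \<Sum>n\<in>?F. b n * f (y - multiple a n)) x"
      by (simp add: continuous_on_eq_continuous_at)
    ultimately show ?thesis by (simp add: isCont_cong)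
  qed
  then have "continuous_on UNIV u" by (simp add: continuous_on_eq_continuous_at)
  then have "weight (\<lambda>x. exp (u x))"
    unfolding weight_def bounded_iff using u_bound
    by (auto intro!: continuous_intros exI[of _ "exp B"] simp: abs_le_iff intro: order_trans[of _ 0])
  moreover have "exp (u (x + multiple a n)) = exp (b n)" if "x \<in> E" for x n
  proof -
    have "I (x + multiple a n) = {n}"
      using P(5)[of "x + multiple a n" n] that E(3) by (auto simp: I_def)
    then show ?thesis using f1[OF that] by (simp add: u_def)
  qed
  ultimately show thesis using that[of "\<lambda>x. exp (u x)" E K] E P by blast
qed

section \<open>Lebesgue spaces as spaces of classes\<close>

abbreviation Lp_class :: "'a measure \<Rightarrow> real \<Rightarrow> ('a \<Rightarrow> complex) \<Rightarrow> ('a \<Rightarrow> complex) set" where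
  "Lp_class M p f \<equiv> ae_eq M p `` {f}"

lemma norm_add_powr_le:
  fixes x y :: "'b::real_normed_vector"
  assumes "p \<ge> 0"
  shows "norm (x + y) powr p \<le> 2 powr p * (norm x powr p + norm y powr p)"
proof -
  have "norm (x + y) \<le> 2 * max (norm x) (norm y)"
    using norm_triangle_ineq[of x y] by linarith
  then have "norm (x + y) powr p \<le> (2 * max (norm x) (norm y)) powr p"
    using assms by (intro powr_mono2) auto
  also have "\<dots> = 2 powr p * max (norm x) (norm y) powr p"
    by (simp add: powr_mult)
  also have "\<dots> \<le> 2 powr p * (norm x powr p + norm y powr p)"
    by (intro mult_left_mono) (auto simp: max_def)
  finally show ?thesis .
qed

lemma Lp_fun_add:
  assumes "f \<in> Lp_fun M p" "g \<in> Lp_fun M p" "p \<ge> 0"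
  shows "(\<lambda>x. f x + g x) \<in> Lp_fun M p"
proof -
  have [measurable]: "f \<in> borel_measurable M" "g \<in> borel_measurable M"
    and int: "integrable M (\<lambda>x. norm (f x) powr p)" "integrable M (\<lambda>x. norm (g x) powr p)"
    using assms by (auto simp: Lp_fun_def)
  have "integrable M (\<lambda>x. norm (f x + g x) powr p)"
  proof (rule Bochner_Integration.integrable_bound)
    show "integrable M (\<lambda>x. 2 powr p * (norm (f x) powr p + norm (g x) powr p))"
      using int by auto
    show "AE x in M. norm (norm (f x + g x) powr p)
            \<le> norm (2 powr p * (norm (f x) powr p + norm (g x) powr p))"
      using norm_add_powr_le[OF assms(3)] by auto
  qed measurable
  then show ?thesis by (simp add: Lp_fun_def)
qed

lemma Lp_fun_scale:
  assumes "f \<in> Lp_fun M p"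
  shows "(\<lambda>x. c * f x) \<in> Lp_fun M p"
  using assms by (auto simp: Lp_fun_def norm_mult powr_mult)

lemma equiv_ae_eq: "equiv (Lp_fun M p) (ae_eq M p)"
proof (rule equivI)
  show "ae_eq M p \<subseteq> Lp_fun M p \<times> Lp_fun M p" by (auto simp: ae_eq_def)
  show "refl_on (Lp_fun M p) (ae_eq M p)" by (auto simp: refl_on_def ae_eq_def)
  show "sym (ae_eq M p)" by (auto simp: sym_def ae_eq_def)
  show "trans (ae_eq M p)" unfolding trans_def ae_eq_def by auto
qed

lemma Lp_class_in: "f \<in> Lp_fun M p \<Longrightarrow> Lp_class M p f \<in> vectors (Lp M p)"
  by (simp add: Lp_def quotientI)

lemma Lp_class_cases:
  assumes "F \<in> vectors (Lp M p)"
  obtains f where "f \<in> Lp_fun M p" "F = Lp_class M p f"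
  using assms by (auto simp: Lp_def elim: quotientE)

lemma Lp_class_eqI: "(f, g) \<in> ae_eq M p \<Longrightarrow> Lp_class M p f = Lp_class M p g"
  by (rule equiv_class_eq[OF equiv_ae_eq])

lemma vadd_Lp_class:
  assumes "f \<in> Lp_fun M p" "g \<in> Lp_fun M p" "p \<ge> 0"
  shows "vadd (Lp M p) (Lp_class M p f) (Lp_class M p g) = Lp_class M p (\<lambda>x. f x + g x)"
proof -
  have "congruent2 (ae_eq M p) (ae_eq M p) (\<lambda>f g. Lp_class M p (\<lambda>x. f x + g x))"
    using assms(3) by (intro congruent2I' Lp_class_eqI) (auto simp: ae_eq_def Lp_fun_add)
  then show ?thesis
    using assms by (simp add: Lp_def UN_equiv_class2[OF equiv_ae_eq equiv_ae_eq])
qed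

lemma vscale_Lp_class:
  assumes "f \<in> Lp_fun M p"
  shows "vscale (Lp M p) c (Lp_class M p f) = Lp_class M p (\<lambda>x. c * f x)"
proof -
  have "congruent (ae_eq M p) (\<lambda>f. Lp_class M p (\<lambda>x. c * f x))"
    by (intro congruentI Lp_class_eqI) (auto simp: ae_eq_def Lp_fun_scale)
  then show ?thesis
    using assms by (simp add: Lp_def UN_equiv_class[OF equiv_ae_eq])
qed

lemma seminorm_p_cong:
  assumes "(f, g) \<in> ae_eq M p"
  shows "seminorm_p M p f = seminorm_p M p g"
proof -
  have [measurable]: "f \<in> borel_measurable M" "g \<in> borel_measurable M" and "AE x in M. f x = g x"
    using assms by (auto simp: ae_eq_def Lp_fun_def)
  then have "(\<integral>x. norm (f x) powr p \<partial>M) = (\<integral>x. norm (g x) powr p \<partial>M)"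
    by (intro integral_cong_AE) auto
  then show ?thesis by (simp add: seminorm_p_def)
qed

lemma vnorm_Lp_class:
  assumes "f \<in> Lp_fun M p"
  shows "vnorm (Lp M p) (Lp_class M p f) = seminorm_p M p f"
proof -
  have "f \<in> Lp_class M p f" by (rule equiv_class_self[OF equiv_ae_eq assms])
  moreover have "seminorm_p M p g = seminorm_p M p f" if "g \<in> Lp_class M p f" for g
    using seminorm_p_cong[of f g M p] that by simp
  ultimately have "seminorm_p M p ` Lp_class M p f = {seminorm_p M p f}" by blast
  then show ?thesis by (simp add: Lp_def)
qed

lemma vdist_Lp_class:
  assumes "f \<in> Lp_fun M p" "g \<in> Lp_fun M p" "p \<ge> 0"
  shows "vdist (Lp M p) (Lp_class M p f) (Lp_class M p g) = seminorm_p M p (\<lambda>x. f x - g x)"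
proof -
  have g: "(\<lambda>x. - 1 * g x) \<in> Lp_fun M p" by (rule Lp_fun_scale[OF assms(2)])
  have sum: "(\<lambda>x. f x + - 1 * g x) \<in> Lp_fun M p"
    by (rule Lp_fun_add[OF assms(1) g assms(3)])
  show ?thesis
    unfolding vdist_def vscale_Lp_class[OF assms(2)] vadd_Lp_class[OF assms(1) g assms(3)]
      vnorm_Lp_class[OF sum] by simp
qed

lemma vdist_Lp_nonneg:
  assumes "F \<in> vectors (Lp M p)" "G \<in> vectors (Lp M p)" "p \<ge> 0"
  shows "0 \<le> vdist (Lp M p) F G"
proof -
  obtain f where f: "f \<in> Lp_fun M p" "F = Lp_class M p f"
    using assms(1) by (rule Lp_class_cases)
  obtain g where g: "g \<in> Lp_fun M p" "G = Lp_class M p g"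
    using assms(2) by (rule Lp_class_cases)
  show ?thesis
    unfolding f(2) g(2) vdist_Lp_class[OF f(1) g(1) assms(3)] seminorm_p_def
    by (rule powr_ge_zero)
qed

lemma Lp_induced_class:
  assumes "\<And>f g. (f, g) \<in> ae_eq M p \<Longrightarrow> (S f, S g) \<in> ae_eq M p" "f \<in> Lp_fun M p"
  shows "Lp_induced M p S (Lp_class M p f) = Lp_class M p (S f)"
proof -
  have "congruent (ae_eq M p) (\<lambda>f. Lp_class M p (S f))"
    using assms(1) by (intro congruentI Lp_class_eqI)
  then show ?thesis
    unfolding Lp_induced_def using assms(2) by (rule UN_equiv_class[OF equiv_ae_eq])
qed

text \<open>
  Linearity and the norm estimate need only be checked on functions, since \<open>S\<close> respects
  almost-everywhere equality.
\<close>

lemma bounded_operator_Lp_induced: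
  assumes p: "p \<ge> 0"
    and resp: "\<And>f g. (f, g) \<in> ae_eq M p \<Longrightarrow> (S f, S g) \<in> ae_eq M p"
    and add: "\<And>f g. S (\<lambda>x. f x + g x) = (\<lambda>x. S f x + S g x)"
    and scale: "\<And>c f. S (\<lambda>x. c * f x) = (\<lambda>x. c * S f x)"
    and bound: "\<And>f. f \<in> Lp_fun M p \<Longrightarrow> seminorm_p M p (S f) \<le> C * seminorm_p M p f"
  shows "bounded_operator (Lp M p) (Lp_induced M p S)"
proof -
  have S: "S f \<in> Lp_fun M p" if "f \<in> Lp_fun M p" for f
    using resp[of f f] that by (auto simp: ae_eq_def)
  note cls = Lp_induced_class[where S = S, OF resp]
  show ?thesis
    unfolding bounded_operator_def
  proof (intro conjI ballI allI exI[of _ C])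
    fix F assume "F \<in> vectors (Lp M p)"
    then obtain f where f: "f \<in> Lp_fun M p" "F = Lp_class M p f" by (rule Lp_class_cases)
    show "Lp_induced M p S F \<in> vectors (Lp M p)" using f S by (simp add: cls Lp_class_in)
    show "vnorm (Lp M p) (Lp_induced M p S F) \<le> C * vnorm (Lp M p) F"
      using f S bound by (simp add: cls vnorm_Lp_class)
    show "Lp_induced M p S (vscale (Lp M p) c F) = vscale (Lp M p) c (Lp_induced M p S F)" for c
      using f S by (simp add: cls vscale_Lp_class Lp_fun_scale scale)
    fix G assume "G \<in> vectors (Lp M p)"
    then obtain g where g: "g \<in> Lp_fun M p" "G = Lp_class M p g" by (rule Lp_class_cases)
    show "Lp_induced M p S (vadd (Lp M p) F G)
          = vadd (Lp M p) (Lp_induced M p S F) (Lp_induced M p S G)"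
      using f g S p by (simp add: cls vadd_Lp_class Lp_fun_add add)
  qed
qed

lemma Lp_induced_funpow_class:
  assumes "\<And>f g. (f, g) \<in> ae_eq M p \<Longrightarrow> (S f, S g) \<in> ae_eq M p" "f \<in> Lp_fun M p"
  shows "(Lp_induced M p S ^^ n) (Lp_class M p f) = Lp_class M p ((S ^^ n) f)
    \<and> (S ^^ n) f \<in> Lp_fun M p"
proof (induction n)
  case (Suc n)
  then have "(S ((S ^^ n) f), S ((S ^^ n) f)) \<in> ae_eq M p"
    by (intro assms(1)) (simp add: ae_eq_def)
  moreover have "Lp_induced M p S (Lp_class M p ((S ^^ n) f)) = Lp_class M p (S ((S ^^ n) f))"
    using Suc by (intro Lp_induced_class assms(1)) auto
  ultimately show ?case using Suc by (simp add: ae_eq_def)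
qed (use assms(2) in simp)

lemma seminorm_p_indicator:
  assumes A: "A \<in> sets M" "p \<ge> 1"
  shows "seminorm_p M p (\<lambda>x. c * indicator A x) = norm c * measure M A powr (1 / p)"
proof -
  have "(\<integral>x. norm (c * indicator A x) powr p \<partial>M) = (\<integral>x. norm c powr p * indicator A x \<partial>M)"
    by (intro Bochner_Integration.integral_cong refl) (auto simp: indicator_def norm_mult)
  also have "\<dots> = norm c powr p * measure M A"
    using sets.sets_into_space[OF A(1)] by (simp add: Int_absorb2)
  finally show ?thesis
    using A(2) by (simp add: seminorm_p_def powr_mult powr_powr)
qed

lemma indicator_in_Lp_fun:
  assumes A: "A \<in> sets M" "emeasure M A < \<infinity>" 
  shows "(\<lambda>x. c * indicator A x) \<in> Lp_fun M p"
proof -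
  have "(\<lambda>x. norm (c * indicator A x) powr p) = (\<lambda>x. norm c powr p * indicator A x)"
    by (auto simp: indicator_def norm_mult)
  then show ?thesis using A by (auto simp: Lp_fun_def)
qed

section \<open>Weighted translations\<close>

lemma right_haar_measure_sets:
  assumes "right_haar_measure M"
  shows "sets M = sets borel" "space M = UNIV"
  using assms sets_eq_imp_space_eq[of M borel]
  by (auto simp: right_haar_measure_def radon_measure_def)

lemma right_translation_measurable:
  fixes M :: "'a::{topological_group_add, t2_space} measure"
  assumes "right_haar_measure M"
  shows "(\<lambda>x. x - g) \<in> measurable M M"
proof -
  have "(\<lambda>x::'a. x - g) \<in> borel_measurable borel"
    by (intro borel_measurable_continuous_onI continuous_intros)
  then show ?thesis
    using measurable_cong_sets[OF right_haar_measure_sets(1) right_haar_measure_sets(1)] assms by blast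
qed

lemma vimage_right_translation: "(\<lambda>x. x - g) -` A = (\<lambda>x. x + g) ` A" for g :: "'a::group_add"
proof (intro equalityI subsetI)
  fix x assume "x \<in> (\<lambda>x. x - g) -` A"
  then show "x \<in> (\<lambda>x. x + g) ` A" by (intro image_eqI[of _ _ "x - g"]) auto
qed auto

lemma distr_right_translation:
  fixes M :: "'a::{topological_group_add, t2_space} measure"
  assumes M: "right_haar_measure M"
  shows "distr M M (\<lambda>x. x - g) = M"
proof (rule measure_eqI)
  fix A assume "A \<in> sets (distr M M (\<lambda>x. x - g))"
  then have A: "A \<in> sets M" by simp
  then have "emeasure (distr M M (\<lambda>x. x - g)) A = emeasure M ((\<lambda>x. x + g) ` A)"
    by (simp add: emeasure_distr right_translation_measurable[OF M] right_haar_measure_sets[OF M]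
        vimage_right_translation)
  also have "\<dots> = emeasure M A"
    using M A right_haar_measure_sets[OF M] unfolding right_haar_measure_def by blast
  finally show "emeasure (distr M M (\<lambda>x. x - g)) A = emeasure M A" .
qed simp

lemma sets_right_translate:
  fixes M :: "'a::{topological_group_add, t2_space} measure"
  assumes M: "right_haar_measure M" and A: "A \<in> sets M"
  shows "(\<lambda>x. x + g) ` A \<in> sets M"
  using measurable_sets[OF right_translation_measurable[OF M] A, of g]
  by (simp add: right_haar_measure_sets[OF M] vimage_right_translation)

text \<open>
  By the Lindelof property countably many right translates of \<open>U\<close> cover the group, and all of
  them have the measure of \<open>U\<close>.
\<close>

lemma right_haar_measure_open_pos:
  fixes M :: "'a::{topological_group_add, second_countable_topology, t2_space} measure"
  assumes M: "right_haar_measure M" and U: "open U" "x \<in> U"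
  shows "emeasure M U > 0"
proof (rule ccontr)
  assume "\<not> 0 < emeasure M U"
  then have U0: "emeasure M U = 0" by simp
  have U_sets: "U \<in> sets M" using U by (simp add: right_haar_measure_sets[OF M])
  define \<F> where "\<F> = range (\<lambda>g. (\<lambda>y. y + g) ` U)"
  have "open S" if S: "S \<in> \<F>" for S
  proof -
    obtain g where "S = (\<lambda>y. y + g) ` U" using S by (auto simp: \<F>_def)
    then show ?thesis
      by (simp only: vimage_right_translation[symmetric]) (intro open_vimage[OF U(1)] continuous_intros)
  qed
  then obtain \<G> where \<G>: "\<G> \<subseteq> \<F>" "countable \<G>" "\<Union>\<G> = \<Union>\<F>"
    using Lindelof by metis
  have "y \<in> \<Union>\<F>" for y
  proof (rule UnionI)
    show "(\<lambda>z. z + (- x + y)) ` U \<in> \<F>" unfolding \<F>_def by (rule rangeI)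
    have "x + (- x + y) = y" by (simp add: add.assoc[symmetric])
    then show "y \<in> (\<lambda>z. z + (- x + y)) ` U" using U(2) by (metis image_eqI)
  qed
  then have "\<Union>\<G> = UNIV" using \<G> by auto
  moreover have "S \<in> null_sets M" if S: "S \<in> \<G>" for S
  proof -
    obtain g where "S = (\<lambda>y. y + g) ` U" using S \<G> by (auto simp: \<F>_def)
    moreover have "emeasure M ((\<lambda>y. y + g) ` U) = 0"
      using M U U0 unfolding right_haar_measure_def by simp
    ultimately show ?thesis using sets_right_translate[OF M U_sets] by auto
  qed
  then have "(\<Union>S\<in>\<G>. S) \<in> null_sets M" using \<G> by (intro null_sets_UN') auto
  ultimately have "UNIV \<in> null_sets M" by simp
  then show False using M by (auto simp: right_haar_measure_def null_sets_def)
qed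

text \<open>
  Translation preserves the measure, hence null sets and integrability; the weight is bounded.
\<close>

lemma weighted_translation_ae_eq:
  fixes M :: "'a::{topological_group_add, second_countable_topology, t2_space} measure"
  assumes M: "right_haar_measure M" and w: "weight w" and p: "p \<ge> 0" and fg: "(f, g) \<in> ae_eq M p"
  shows "(weighted_translation a w f, weighted_translation a w g) \<in> ae_eq M p"
proof -
  have w_meas: "w \<in> borel_measurable M"
  proof -
    have "w \<in> borel_measurable borel"
      using w by (intro borel_measurable_continuous_onI) (simp add: weight_def)
    then show ?thesis
      using measurable_cong_sets[OF right_haar_measure_sets(1)[OF M] refl] by blast
  qed
  obtain C where C: "\<And>x. \<bar>w x\<bar> \<le> C"
    using w unfolding weight_def bounded_iff by auto
  have Lp: "weighted_translation a w h \<in> Lp_fun M p" if h: "h \<in> Lp_fun M p" for h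
  proof -
    have h_meas: "h \<in> borel_measurable M" and h_int: "integrable M (\<lambda>x. norm (h x) powr p)"
      using h by (auto simp: Lp_fun_def)
    have trans_meas: "(\<lambda>x. h (x - a)) \<in> borel_measurable M"
      by (rule measurable_compose[OF right_translation_measurable[OF M] h_meas])
    have [measurable]: "weighted_translation a w h \<in> borel_measurable M"
      unfolding weighted_translation_def translation_def
      by (intro borel_measurable_times trans_meas
          measurable_compose[OF w_meas borel_measurable_of_real])
    have int: "integrable M (\<lambda>x. norm (h (x - a)) powr p)"
      using integrable_distr[OF right_translation_measurable[OF M], of a "\<lambda>x. norm (h x) powr p"] h_int
      by (simp add: distr_right_translation[OF M])
    have "integrable M (\<lambda>x. norm (weighted_translation a w h x) powr p)"
    proof (rule Bochner_Integration.integrable_bound)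
      show "integrable M (\<lambda>x. C powr p * norm (h (x - a)) powr p)" using int by simp
      show "AE x in M. norm (norm (weighted_translation a w h x) powr p)
              \<le> norm (C powr p * norm (h (x - a)) powr p)"
        using C p
        by (auto simp: weighted_translation_def translation_def norm_mult powr_mult
            intro!: mult_right_mono powr_mono2)
    qed measurable
    then show ?thesis by (simp add: Lp_fun_def)
  qed
  have f: "f \<in> Lp_fun M p" and g: "g \<in> Lp_fun M p" and ae: "AE x in M. f x = g x"
    using fg by (auto simp: ae_eq_def)
  have [measurable]: "f \<in> borel_measurable M" "g \<in> borel_measurable M"
    using f g by (auto simp: Lp_fun_def)
  have "{x \<in> space M. f x = g x} \<in> sets M" by measurable
  then have "AE x in M. f (x - a) = g (x - a)"
    using AE_distr_iff[OF right_translation_measurable[OF M], of "\<lambda>x. f x = g x" a] ae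
    unfolding distr_right_translation[OF M] by blast
  then have "AE x in M. weighted_translation a w f x = weighted_translation a w g x"
    by (auto simp: weighted_translation_def translation_def)
  then show ?thesis using Lp f g by (simp add: ae_eq_def)
qed

lemma bounded_operator_weighted_translation:
  fixes M :: "'a::{topological_group_add, second_countable_topology, t2_space} measure"
  assumes M: "right_haar_measure M" and w: "weight w" and p: "p \<ge> 1"
  shows "bounded_operator (Lp M p) (Lp_induced M p (weighted_translation a w))"
proof -
  obtain C where C: "\<And>x. \<bar>w x\<bar> \<le> C"
    using w unfolding weight_def bounded_iff by auto
  have "C \<ge> 0" using C[of 0] by linarith
  show ?thesis
  proof (rule bounded_operator_Lp_induced)
    show "0 \<le> p" using p by simp
    show "(weighted_translation a w f, weighted_translation a w g) \<in> ae_eq M p"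
      if "(f, g) \<in> ae_eq M p" for f g
      using weighted_translation_ae_eq[OF M w _ that] p by simp
    fix f assume f: "f \<in> Lp_fun M p"
    have h_int: "integrable M (\<lambda>x. norm (f x) powr p)" using f by (simp add: Lp_fun_def)
    then have int: "integrable M (\<lambda>x. norm (f (x - a)) powr p)"
      using integrable_distr[OF right_translation_measurable[OF M], of a "\<lambda>x. norm (f x) powr p"]
      by (simp add: distr_right_translation[OF M])
    have "(\<integral>x. norm (weighted_translation a w f x) powr p \<partial>M)
        \<le> (\<integral>x. C powr p * norm (f (x - a)) powr p \<partial>M)"
      using int C p
      by (intro integral_mono') (auto simp: weighted_translation_def translation_def norm_mult powr_mult
            intro!: mult_right_mono powr_mono2)
    also have "\<dots> = C powr p * (\<integral>x. norm (f x) powr p \<partial>M)"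
      using integral_distr[OF right_translation_measurable[OF M], of "\<lambda>x. norm (f x) powr p" a] h_int
      by (simp add: distr_right_translation[OF M])
    finally have "seminorm_p M p (weighted_translation a w f)
        \<le> (C powr p * (\<integral>x. norm (f x) powr p \<partial>M)) powr (1 / p)"
      unfolding seminorm_p_def using p by (intro powr_mono2) auto
    also have "\<dots> = C * seminorm_p M p f"
      using p \<open>C \<ge> 0\<close> by (simp add: seminorm_p_def powr_mult powr_powr)
    finally show "seminorm_p M p (weighted_translation a w f) \<le> C * seminorm_p M p f" .
  qed (simp_all add: weighted_translation_def translation_def distrib_left mult.left_commute)
qed

text \<open>
  The values of the weight along the orbit are the exponentials of the increments of \<open>s\<close>, so their
  product telescopes.
\<close>

lemma funpow_weighted_translation_indicator:
  fixes a :: "'a::group_add"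
  assumes w: "\<And>x n. x \<in> E \<Longrightarrow> w (x + multiple a (Suc n)) = exp (s (Suc n) - s n)" and s: "s 0 = 0"
  shows "(weighted_translation a w ^^ n) (\<lambda>x. c * indicator E x)
    = (\<lambda>x. c * complex_of_real (exp (s n)) * indicator ((\<lambda>x. x + multiple a n) ` E) x)"
proof (induction n)
  case (Suc n)
  have shift: "x - a \<in> (\<lambda>x. x + multiple a n) ` E \<longleftrightarrow> x \<in> (\<lambda>x. x + multiple a (Suc n)) ` E" for x
  proof -
    have "x - a = y + multiple a n \<longleftrightarrow> x = y + multiple a (Suc n)" for y
      by (simp only: multiple_Suc_right diff_eq_eq add.assoc)
    then show ?thesis by (simp only: image_iff)
  qed
  have step: "complex_of_real (w x) * (c * complex_of_real (exp (s n)))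
      = c * complex_of_real (exp (s (Suc n)))" if "x \<in> (\<lambda>x. x + multiple a (Suc n)) ` E" for x
  proof -
    have "w x = exp (s (Suc n) - s n)" using that w by blast
    then have "w x * exp (s n) = exp (s (Suc n))" by (simp add: exp_diff)
    then have "complex_of_real (w x) * complex_of_real (exp (s n)) = complex_of_real (exp (s (Suc n)))"
      by (simp only: of_real_mult[symmetric])
    then show ?thesis by (simp only: mult.left_commute[of "complex_of_real (w x)"])
  qed
  have "(weighted_translation a w ^^ Suc n) (\<lambda>x. c * indicator E x)
      = weighted_translation a w
          (\<lambda>x. c * complex_of_real (exp (s n)) * indicator ((\<lambda>x. x + multiple a n) ` E) x)"
    using Suc by (simp only: funpow.simps o_apply)
  also have "\<dots> = (\<lambda>x. c * complex_of_real (exp (s (Suc n)))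
      * indicator ((\<lambda>x. x + multiple a (Suc n)) ` E) x)"
    unfolding weighted_translation_def translation_def
  proof
    fix x
    show "complex_of_real (w x) * (c * complex_of_real (exp (s n))
        * indicator ((\<lambda>x. x + multiple a n) ` E) (x - a))
      = c * complex_of_real (exp (s (Suc n))) * indicator ((\<lambda>x. x + multiple a (Suc n)) ` E) x"
      unfolding indicator_def shift using step[of x]
      by (cases "x \<in> (\<lambda>x. x + multiple a (Suc n)) ` E") (simp_all only: of_bool_eq mult_1_right mult_zero_right)
  qed
  finally show ?case .
qed (simp add: s)

section \<open>Chaos from a slow oscillation\<close>

text \<open>
  A curve of vectors on which the \<open>n\<close>-th power of \<open>T\<close> scales all distances by \<open>exp (osc n)\<close> is a
  scrambled set. The case \<open>n = 0\<close> shows that the curve is injective, hence uncountable.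
\<close>

lemma distributionally_chaotic_if_osc:
  fixes \<gamma> :: "real \<Rightarrow> 'v"
  assumes T: "bounded_operator X T" and \<gamma>: "\<And>c. \<gamma> c \<in> vectors X" and "\<kappa> > 0"
    and orbit: "\<And>n c d. vdist X ((T ^^ n) (\<gamma> c)) ((T ^^ n) (\<gamma> d)) = \<bar>c - d\<bar> * \<kappa> * exp (osc n)"
  shows "distributionally_chaotic X T"
  unfolding distributionally_chaotic_def
proof (intro conjI T exI[of _ "range \<gamma>"] exI[of _ 1] allI impI ballI)
  have "inj \<gamma>"
  proof (rule injI, rule ccontr)
    fix c d assume "\<gamma> c = \<gamma> d" "c \<noteq> d"
    then show False using orbit[of 0 c d] orbit[of 0 c c] \<open>\<kappa> > 0\<close> by simp
  qed
  then show "uncountable (range \<gamma>)"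
    using countable_image_inj_on[of \<gamma> UNIV] uncountable_UNIV_real by auto
next
  fix \<tau> :: real and x y assume "\<tau> > 0" "x \<in> range \<gamma>" "y \<in> range \<gamma>" "x \<noteq> y"
  then obtain c d where cd: "x = \<gamma> c" "y = \<gamma> d" "c \<noteq> d" by auto
  define r where "r = ln (\<bar>c - d\<bar> * \<kappa>)"
  have "\<bar>c - d\<bar> * \<kappa> = exp r" using cd \<open>\<kappa> > 0\<close> by (simp add: r_def)
  then have dist: "vdist X ((T ^^ n) x) ((T ^^ n) y) = exp (r + osc n)" for n
    by (simp add: cd orbit exp_add)
  show "upper_dens {n. 1 \<le> n \<and> 1 \<le> vdist X ((T ^^ n) x) ((T ^^ n) y)} = 1"
    by (rule upper_dens_mono_1[OF osc_high[of "- r"]]) (auto simp: dist)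
  have "exp (r + osc n) < \<tau>" if "osc n \<le> ln \<tau> - r - 1" for n
  proof -
    have "exp (r + osc n) < exp (ln \<tau>)" using that by simp
    then show ?thesis using \<open>\<tau> > 0\<close> by simp
  qed
  then have "{n. 1 \<le> n \<and> osc n \<le> ln \<tau> - r - 1}
      \<subseteq> {n. 1 \<le> n \<and> vdist X ((T ^^ n) x) ((T ^^ n) y) < \<tau>}"
    unfolding dist by blast
  then show "upper_dens {n. 1 \<le> n \<and> vdist X ((T ^^ n) x) ((T ^^ n) y) < \<tau>} = 1"
    by (rule upper_dens_mono_1[OF osc_low])
next
  show "range \<gamma> \<subseteq> vectors X" using \<gamma> by blast
qed simp

text \<open>
  Sets of upper density one are infinite, so the distances along the orbits of a pair are
  infinitely often at least \<open>\<epsilon>\<close>, and infinitely often below any \<open>\<tau> > 0\<close>.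
\<close>

lemma li_yorke_chaotic_if_distributionally_chaotic:
  assumes chaos: "distributionally_chaotic X T"
    and nonneg: "\<And>x y. x \<in> vectors X \<Longrightarrow> y \<in> vectors X \<Longrightarrow> 0 \<le> vdist X x y"
  shows "li_yorke_chaotic X T"
proof -
  obtain \<Gamma> \<epsilon> where T: "bounded_operator X T" and \<Gamma>: "\<Gamma> \<subseteq> vectors X" "uncountable \<Gamma>" and "0 < \<epsilon>"
    and scrambled: "\<forall>\<tau>>0. \<forall>x\<in>\<Gamma>. \<forall>y\<in>\<Gamma>. x \<noteq> y \<longrightarrow>
      upper_dens {n. 1 \<le> n \<and> \<epsilon> \<le> vdist X ((T ^^ n) x) ((T ^^ n) y)} = 1 \<and>
      upper_dens {n. 1 \<le> n \<and> vdist X ((T ^^ n) x) ((T ^^ n) y) < \<tau>} = 1"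
    using chaos unfolding distributionally_chaotic_def by (elim conjE exE) (rule that)
  have far: "upper_dens {n. 1 \<le> n \<and> \<epsilon> \<le> vdist X ((T ^^ n) x) ((T ^^ n) y)} = 1"
    if "x \<in> \<Gamma>" "y \<in> \<Gamma>" "x \<noteq> y" for x y
    using scrambled[rule_format, of 1 x y] that by simp
  have near: "upper_dens {n. 1 \<le> n \<and> vdist X ((T ^^ n) x) ((T ^^ n) y) < \<tau>} = 1"
    if "0 < \<tau>" "x \<in> \<Gamma>" "y \<in> \<Gamma>" "x \<noteq> y" for \<tau> x y
    using scrambled[rule_format, of \<tau> x y] that by simp
  have orbit: "(T ^^ n) x \<in> vectors X" if "x \<in> \<Gamma>" for n x
    by (induction n) (use that T \<Gamma> in \<open>auto simp: bounded_operator_def\<close>)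
  have "liminf (\<lambda>n. ereal (vdist X ((T ^^ n) x) ((T ^^ n) y))) = 0 \<and>
        limsup (\<lambda>n. ereal (vdist X ((T ^^ n) x) ((T ^^ n) y))) > 0" (is "liminf ?d = 0 \<and> limsup ?d > 0")
    if xy: "x \<in> \<Gamma>" "y \<in> \<Gamma>" "x \<noteq> y" for x y
  proof
    have "0 \<le> liminf ?d"
      using nonneg orbit xy by (intro Liminf_bounded always_eventually allI) simp
    moreover have "\<not> 0 < liminf ?d"
    proof
      assume "0 < liminf ?d"
      then obtain \<tau> :: real where \<tau>: "0 < ereal \<tau>" "ereal \<tau> < liminf ?d"
        using ereal_dense2 by blast
      then have "eventually (\<lambda>n. ereal \<tau> < ?d n) sequentially" by (intro less_LiminfD) simp
      then obtain N where N: "\<And>n. n \<ge> N \<Longrightarrow> \<tau> < vdist X ((T ^^ n) x) ((T ^^ n) y)"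
        by (auto simp: eventually_sequentially)
      obtain n where "n > N" "vdist X ((T ^^ n) x) ((T ^^ n) y) < \<tau>"
        using infinite_if_upper_dens_1[OF near[of \<tau>, OF _ xy]] \<tau>(1) unfolding infinite_nat_iff_unbounded by auto
      then show False using N[of n] by simp
    qed
    ultimately show "liminf ?d = 0" by simp
    show "limsup ?d > 0"
    proof (rule ccontr)
      assume "\<not> limsup ?d > 0"
      then have "limsup ?d < ereal \<epsilon>" using \<open>0 < \<epsilon>\<close> by (meson ereal_less(2) leI le_less_trans)
      then have "eventually (\<lambda>n. ?d n < ereal \<epsilon>) sequentially" by (intro Limsup_lessD) simp
      then obtain N where N: "\<And>n. n \<ge> N \<Longrightarrow> vdist X ((T ^^ n) x) ((T ^^ n) y) < \<epsilon>"
        by (auto simp: eventually_sequentially)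
      obtain n where "n > N" "\<epsilon> \<le> vdist X ((T ^^ n) x) ((T ^^ n) y)"
        using infinite_if_upper_dens_1[OF far[OF xy]] unfolding infinite_nat_iff_unbounded by auto
      then show False using N[of n] by simp
    qed
  qed
  then show ?thesis unfolding li_yorke_chaotic_def using T \<Gamma> by blast
qed

theorem theorem2p12:
  fixes M :: "'a::{topological_group_add, second_countable_topology, t2_space} measure"
    and a :: 'a
  assumes "locally_compact_space (euclidean :: 'a topology)"
    and "right_haar_measure M"
    and "aperiodic a"
  shows "\<exists>w. weight w \<and>
           (\<forall>p\<ge>1. distributionally_chaotic (Lp M p) (Lp_induced M p (weighted_translation a w))) \<and>
           (\<forall>p\<ge>1. li_yorke_chaotic (Lp M p) (Lp_induced M p (weighted_translation a w)))"
proof -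
  note M = \<open>right_haar_measure M\<close>
  \<comment> \<open>Truncated subtraction gives \<open>b 0 = 0\<close>: the weight is \<open>1\<close> on \<open>E\<close> itself.\<close>
  define b where "b n = osc n - osc (n - 1)" for n
  have "\<bar>b n\<bar> \<le> 2" for n using osc_step[of "n - 1"] by (cases n) (auto simp: b_def)
  then obtain w E K where w: "weight w" and E: "open E" "0 \<in> E" "E \<subseteq> K" "compact K"
    and wE: "\<And>x n. x \<in> E \<Longrightarrow> w (x + multiple a n) = exp (b n)"
    using weight_along_orbit[OF assms(1,3)] by metis
  have E_sets: "E \<in> sets M" using E by (simp add: right_haar_measure_sets[OF M])
  have K_sets: "K \<in> sets borel" using E by (simp add: borel_closed compact_imp_closed)
  have "emeasure M E \<le> emeasure M K"
    using E K_sets by (intro emeasure_mono) (auto simp: right_haar_measure_sets[OF M])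
  also have "\<dots> < \<infinity>"
    using M E K_sets by (auto simp: right_haar_measure_def radon_measure_def)
  finally have E_fin: "emeasure M E < \<infinity>" .
  have E_pos: "measure M E > 0"
    using right_haar_measure_open_pos[OF M E(1,2)] E_fin by (simp add: measure_def enn2real_positive_iff)
  let ?S = "weighted_translation a w"
  have "distributionally_chaotic (Lp M p) (Lp_induced M p ?S)" if p: "p \<ge> 1" for p
  proof -
    define f :: "real \<Rightarrow> 'a \<Rightarrow> complex" where "f c = (\<lambda>x. complex_of_real c * indicator E x)" for c
    have f: "f c \<in> Lp_fun M p" for c
      unfolding f_def using E_sets E_fin by (rule indicator_in_Lp_fun)
    define \<gamma> where "\<gamma> c = Lp_class M p (f c)" for c
    have orbit: "(Lp_induced M p ?S ^^ n) (\<gamma> c) = Lp_class M p ((?S ^^ n) (f c))"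
      and orbit_Lp: "(?S ^^ n) (f c) \<in> Lp_fun M p" for n c
      using Lp_induced_funpow_class[where S = ?S and f = "f c" and n = n and p = p,
          OF weighted_translation_ae_eq[OF M w] f] p
      by (auto simp: \<gamma>_def)
    show ?thesis
    proof (rule distributionally_chaotic_if_osc[where \<gamma> = \<gamma> and \<kappa> = "measure M E powr (1 / p)"])
      show "bounded_operator (Lp M p) (Lp_induced M p ?S)"
        by (rule bounded_operator_weighted_translation[OF M w p])
      show "\<gamma> c \<in> vectors (Lp M p)" for c
        unfolding \<gamma>_def using f by (rule Lp_class_in)
      show "0 < measure M E powr (1 / p)" using E_pos by simp
      fix n c d
      define En where "En = (\<lambda>x. x + multiple a n) ` E"
      have En: "En \<in> sets M"
        unfolding En_def by (rule sets_right_translate[OF M E_sets])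
      have "measure M En = measure M E"
        using M E_sets unfolding measure_def En_def right_haar_measure_def
        by (simp add: right_haar_measure_sets[OF M])
      have iter: "(?S ^^ n) (f c) = (\<lambda>x. complex_of_real c * complex_of_real (exp (osc n)) * indicator En x)" for c
        unfolding f_def En_def
        by (rule funpow_weighted_translation_indicator) (simp_all add: wE b_def del: multiple_Suc)
      have "vdist (Lp M p) ((Lp_induced M p ?S ^^ n) (\<gamma> c)) ((Lp_induced M p ?S ^^ n) (\<gamma> d))
          = seminorm_p M p (\<lambda>x. (?S ^^ n) (f c) x - (?S ^^ n) (f d) x)"
        unfolding orbit using p by (intro vdist_Lp_class orbit_Lp) simp
      also have "\<dots> = seminorm_p M p (\<lambda>x. complex_of_real ((c - d) * exp (osc n)) * indicator En x)"
        unfolding iter by (simp add: left_diff_distrib)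
      also have "\<dots> = \<bar>c - d\<bar> * measure M E powr (1 / p) * exp (osc n)"
        using \<open>measure M En = measure M E\<close>
        by (simp only: seminorm_p_indicator[OF En p] norm_of_real) (simp add: abs_mult)
      finally show "vdist (Lp M p) ((Lp_induced M p ?S ^^ n) (\<gamma> c)) ((Lp_induced M p ?S ^^ n) (\<gamma> d))
          = \<bar>c - d\<bar> * measure M E powr (1 / p) * exp (osc n)" .
    qed
  qed
  moreover from this have "li_yorke_chaotic (Lp M p) (Lp_induced M p ?S)" if "p \<ge> 1" for p
    using that by (intro li_yorke_chaotic_if_distributionally_chaotic vdist_Lp_nonneg) auto
  ultimately show ?thesis using w by blast
qed

end
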